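(* Let $\lambda,\delta\in\mathbb{D}$ be nonzero and let $$\alpha_0=\frac{1}{2}\left(\frac{1}{\bar{\lambda}}+\lambda+\frac{1}{\bar{\delta}}+\delta\right).$$ Then $$c_N(p(\lambda),p(\delta))=\begin{cases}\rho(\lambda^2,\delta^2) & \text{if } |\alpha_0|\ge 1,\\ \rho\big(\lambda^2\phi_{\alpha_0}(\lambda),\,\delta^2\phi_{\alpha_0}(\delta)\big) & \text{if } |\alpha_0|<1.\end{cases}$$ Also, $c_N(p(0),p(\lambda))=\rho(0,\lambda^2)=\tanh^{-1}|\lambda|^2$.
   Context: $\mathbb{D}$ is the open unit disk in $\mathbb{C}$. The Neil parabola is $N=\{(z,w)\in\mathbb{D}^2: z^2=w^3\}$, and $p:\mathbb{D}\to N$ is the bijective map $p(\lambda)=(\lambda^3,\lambda^2)$. For $\alpha\in\mathbb{D}$, $\phi_\alpha(z)=\frac{\alpha-z}{1-\bar{\alpha}z}$. For $a,b\in\mathbb{D}$, $m(a,b)=\left|\frac{a-b}{1-\bar a b}\right|$ (pseudo-hyperbolic distance) and $\rho(a,b)=\tanh^{-1}m(a,b)$ (Poincaré distance). A function $f:N\to\mathbb{C}$ is holomorphic if for each $x\in N$ there is a holomorphic function $F$ on a neighborhood $U$ of $x$ in $\mathbb{D}^2$ with $F=f$ on $U\cap N$; $\mathcal{O}(N,\mathbb{D})$ is the set of holomorphic functions on $N$ with values in $\mathbb{D}$. The Carathéodory pseudodistance on $N$ is $c_N(x,y)=\sup\{\rho(f(x),f(y)): f\in\mathcal{O}(N,\mathbb{D})\}$.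 *)

theory Defs
  imports "HOL-Analysis.Analysis"
begin

abbreviation unit_disk :: "complex set" ("\<bbbD>")
  where "\<bbbD> \<equiv> ball 0 1"

definition Neil_parabola :: "(complex \<times> complex) set"
  where "Neil_parabola = {(z, w). z \<in> \<bbbD> \<and> w \<in> \<bbbD> \<and> z\<^sup>2 = w ^ 3}"

definition Neil_param :: "complex \<Rightarrow> complex \<times> complex"
  where "Neil_param l = (l ^ 3, l\<^sup>2)"

definition disk_auto :: "complex \<Rightarrow> complex \<Rightarrow> complex"
  where "disk_auto \<alpha> z = (\<alpha> - z) / (1 - cnj \<alpha> * z)"

definition pseudo_hyperbolic :: "complex \<Rightarrow> complex \<Rightarrow> real"
  where "pseudo_hyperbolic a b = cmod ((a - b) / (1 - cnj a * b))"

definition poincare_dist :: "complex \<Rightarrow> complex \<Rightarrow> real"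
  where "poincare_dist a b = artanh (pseudo_hyperbolic a b)"

text \<open>
  Holomorphy in two complex variables (meant for open sets): the Frechet derivative
  exists at every point and is complex linear, i.e. of the form
  \<open>(h, k) \<mapsto> a h + b k\<close>.
\<close>

definition holomorphic2_on :: "(complex \<times> complex \<Rightarrow> complex) \<Rightarrow> (complex \<times> complex) set \<Rightarrow> bool"
  where "holomorphic2_on F U \<longleftrightarrow>
    (\<forall>x\<in>U. \<exists>a b. (F has_derivative (\<lambda>h. a * fst h + b * snd h)) (at x))"

text \<open>Only the values of \<open>f\<close> on the Neil parabola matter in the next two definitions.\<close>

definition holomorphic_on_Neil :: "(complex \<times> complex \<Rightarrow> complex) \<Rightarrow> bool"
  where "holomorphic_on_Neil f \<longleftrightarrow>
    (\<forall>x\<in>Neil_parabola. \<exists>U F. open U \<and> x \<in> U \<and> U \<subseteq> \<bbbD> \<times> \<bbbD> \<and>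
       holomorphic2_on F U \<and> (\<forall>y\<in>U \<inter> Neil_parabola. F y = f y))"

definition Neil_to_disk :: "(complex \<times> complex \<Rightarrow> complex) set"
  where "Neil_to_disk = {f. holomorphic_on_Neil f \<and> f ` Neil_parabola \<subseteq> \<bbbD>}"

text \<open>The supremum is taken in the extended reals, so that it is meaningful without
  first knowing that the set of distances is bounded.\<close>

definition caratheodory_Neil :: "complex \<times> complex \<Rightarrow> complex \<times> complex \<Rightarrow> ereal"
  where "caratheodory_Neil x y = (SUP f\<in>Neil_to_disk. ereal (poincare_dist (f x) (f y)))"

end

theory Submission
  imports Defs "HOL-Complex_Analysis.Complex_Analysis"
begin

text \<open>
  Pulling back along \<open>p t = (t\<^sup>3, t\<^sup>2)\<close> turns a holomorphic function on the Neil parabola into a function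
  \<open>g\<close> on the disk with \<open>g' 0 = 0\<close> (\<open>Neil_pullback\<close>). One may assume \<open>g 0 = 0\<close>, since
  disk automorphisms preserve the pseudo-hyperbolic distance \<open>m\<close>. Then \<open>g z = z\<^sup>2 * h z\<close> with \<open>|h| \<le> 1\<close>, by two
  applications of the Schwarz lemma (\<open>bounded_holomorphic_double_zero\<close>). This settles the
  distance from the origin; for \<open>l, d \<noteq> 0\<close> one has to maximise \<open>m (l\<^sup>2 * h l) (d\<^sup>2 * h d)\<close> over all such \<open>h\<close>.
  
  By the Schwarz-Pick lemma, \<open>h d\<close> ranges over a closed disk once \<open>h l\<close> is given, and the quantity to be
  maximised is the modulus of a holomorphic function of \<open>h d\<close>. The maximum modulus principle therefore
  reduces the problem to automorphisms \<open>h = \<eta> * disk_auto a\<close> with \<open>|\<eta>| = 1\<close>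
  (\<open>pseudo_hyperbolic_interpolation_le_extremal\<close>), next to the unimodular constants.
  
  For these, \<open>m\<close> equals \<open>m l d\<close> times the quotient of the moduli of two explicit
  polynomials \<open>num\<close> and \<open>den\<close> in \<open>a\<close> and its conjugate. With \<open>c\<close> for the number \<open>\<alpha>\<^sub>0\<close> of the
  theorem, both moduli are invariant under the reflection of \<open>a\<close> in \<open>c\<close>. Write \<open>k\<close> for
  \<open>|l + d| / |1 + cnj l * d|\<close>, which is the value of the quotient on the circle \<open>|a| = 1\<close>, where the
  Blaschke factor is constant. The symmetry leads to the identity
  \<open>|num|\<^sup>2 - k\<^sup>2 * |den|\<^sup>2 = const * (|a|\<^sup>2 - 1) * (|a - 2c|\<^sup>2 - 1)\<close> with a nonnegative constant
  (\<open>Blaschke_identity\<close>). If \<open>|c| \<ge> 1\<close>, the right-hand side is nonpositive on the disk, and constant \<open>h\<close> are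
  optimal. If \<open>|c| < 1\<close>, the right-hand side divided by \<open>|den|\<^sup>2\<close> is largest at \<open>a = c\<close>
  (\<open>critical_comparison\<close>), so \<open>disk_auto c\<close> is optimal.
  
  Both extremal functions live on the Neil parabola: \<open>z\<^sup>2\<close> is the second coordinate, and
  \<open>z\<^sup>2 * disk_auto c z\<close> extends by \<open>Blaschke_extends_Neil\<close>.
\<close>

section \<open>The pseudo-hyperbolic distance and disk automorphisms\<close>

lemma one_minus_cnj_mult_nonzero:
  fixes a b :: complex
  assumes "cmod a < 1" "cmod b \<le> 1"
  shows "1 - cnj a * b \<noteq> 0"
proof
  assume "1 - cnj a * b = 0"
  then have "cmod (cnj a * b) = 1" by simp
  moreover have "cmod (cnj a * b) \<le> cmod a * 1"
    unfolding norm_mult complex_mod_cnj by (intro mult_left_mono assms) auto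
  ultimately show False using assms by linarith
qed

lemma one_plus_cnj_mult_nonzero:
  assumes "cmod a < 1" "cmod b < 1"
  shows "1 + cnj a * b \<noteq> 0"
  using one_minus_cnj_mult_nonzero[of a "- b"] assms by simp

lemma norm_one_minus_cnj_mult_sq:
  "(cmod (1 - cnj a * b))\<^sup>2 = (cmod (a - b))\<^sup>2 + (1 - (cmod a)\<^sup>2) * (1 - (cmod b)\<^sup>2)"
proof -
  have "complex_of_real ((cmod (1 - cnj a * b))\<^sup>2)
      = complex_of_real ((cmod (a - b))\<^sup>2 + (1 - (cmod a)\<^sup>2) * (1 - (cmod b)\<^sup>2))"
    by (simp only: of_real_add of_real_mult of_real_diff of_real_1 complex_norm_square)
       (simp add: algebra_simps)
  then show ?thesis by (simp only: of_real_eq_iff)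
qed

lemma pseudo_hyperbolic_nonneg: "0 \<le> pseudo_hyperbolic a b"
  by (simp add: pseudo_hyperbolic_def)

lemma pseudo_hyperbolic_0: "pseudo_hyperbolic 0 z = cmod z"
  by (simp add: pseudo_hyperbolic_def)

lemma pseudo_hyperbolic_lt_1:
  assumes "cmod a < 1" "cmod b < 1"
  shows "pseudo_hyperbolic a b < 1"
proof -
  have "0 < (1 - (cmod a)\<^sup>2) * (1 - (cmod b)\<^sup>2)"
    using assms by (simp add: power_less_one_iff)
  then have "(cmod (a - b))\<^sup>2 < (cmod (1 - cnj a * b))\<^sup>2"
    by (simp add: norm_one_minus_cnj_mult_sq)
  then have "cmod (a - b) < cmod (1 - cnj a * b)"
    by (rule power2_less_imp_less) simp
  moreover have "0 < cmod (1 - cnj a * b)"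
    using one_minus_cnj_mult_nonzero[of a b] assms by simp
  ultimately show ?thesis
    by (simp add: pseudo_hyperbolic_def norm_divide divide_less_eq)
qed

lemma pseudo_hyperbolic_eq_norm_disk_auto: "pseudo_hyperbolic a b = cmod (disk_auto a b)"
  by (simp add: pseudo_hyperbolic_def disk_auto_def)

lemma norm_disk_auto_lt_1:
  assumes "cmod a < 1" "cmod b < 1"
  shows "cmod (disk_auto a b) < 1"
  using pseudo_hyperbolic_lt_1[OF assms] by (simp add: pseudo_hyperbolic_eq_norm_disk_auto)

lemma disk_auto_involution:
  assumes "cmod a < 1" "cmod z < 1"
  shows "disk_auto a (disk_auto a z) = z"
proof -
  have nz: "1 - cnj a * z \<noteq> 0" "1 - cnj a * a \<noteq> 0"
    using one_minus_cnj_mult_nonzero assms by auto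
  have "a - disk_auto a z = (1 - cnj a * a) * z / (1 - cnj a * z)"
    "1 - cnj a * disk_auto a z = (1 - cnj a * a) / (1 - cnj a * z)"
    using nz(1) by (simp_all add: disk_auto_def divide_simps) (simp_all add: algebra_simps)
  then show ?thesis using nz by (simp add: disk_auto_def[of a "disk_auto a z"])
qed

lemma pseudo_hyperbolic_disk_auto:
  assumes "cmod c < 1" "cmod a < 1" "cmod b < 1"
  shows "pseudo_hyperbolic (disk_auto c a) (disk_auto c b) = pseudo_hyperbolic a b"
proof -
  have nz: "1 - cnj c * a \<noteq> 0" "1 - cnj c * b \<noteq> 0" "1 - cnj c * c \<noteq> 0" "1 - c * cnj a \<noteq> 0"
     "1 - cnj a * b \<noteq> 0"
    using one_minus_cnj_mult_nonzero[of c a] one_minus_cnj_mult_nonzero[of c b]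
      one_minus_cnj_mult_nonzero[of c c] one_minus_cnj_mult_nonzero[of a c]
      one_minus_cnj_mult_nonzero[of a b] assms
    by (auto simp: mult.commute)
  have num: "disk_auto c a - disk_auto c b
      = - ((1 - cnj c * c) * (a - b)) / ((1 - cnj c * a) * (1 - cnj c * b))"
    using nz by (simp add: disk_auto_def divide_simps) (simp add: algebra_simps)
  have den: "1 - cnj (disk_auto c a) * disk_auto c b
      = (1 - cnj c * c) * (1 - cnj a * b) / ((1 - c * cnj a) * (1 - cnj c * b))"
    using nz by (simp add: disk_auto_def divide_simps) (simp add: algebra_simps)
  have cn: "cmod (1 - c * cnj a) = cmod (1 - cnj c * a)"
    by (metis complex_cnj_cnj complex_cnj_diff complex_cnj_mult complex_cnj_one complex_mod_cnj)
  show ?thesis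
    using nz unfolding pseudo_hyperbolic_def num den norm_divide norm_mult norm_minus_cancel cn
    by (simp add: divide_simps)
qed

lemma pseudo_hyperbolic_rotate:
  assumes "cmod u = 1"
  shows "pseudo_hyperbolic (u * a) (u * b) = pseudo_hyperbolic a b"
proof -
  have u: "u * cnj u = 1" using assms complex_norm_square[of u] by simp
  have "1 - cnj (u * a) * (u * b) = 1 - (u * cnj u) * (cnj a * b)" by (simp add: mult_ac)
  also have "\<dots> = 1 - cnj a * b" by (simp add: u)
  finally have "1 - cnj (u * a) * (u * b) = 1 - cnj a * b" .
  moreover have "cmod (u * a - u * b) = cmod (a - b)"
    using assms by (simp add: norm_mult flip: right_diff_distrib)
  ultimately show ?thesis unfolding pseudo_hyperbolic_def norm_divide by (simp only:)
qed

text \<open>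
  The automorphisms of the disk, up to rotation, are closed under composition. The parameter
  of the composite is its zero: the inner map must take the value \<open>cnj \<zeta> * a\<close> there, and
  \<open>disk_auto l\<close> is its own inverse.
\<close>

lemma disk_auto_compose:
  assumes "cmod a < 1" "cmod l < 1" "cmod \<zeta> = 1"
  obtains \<eta> \<alpha> where "cmod \<eta> = 1" "cmod \<alpha> < 1"
    "\<And>z. cmod z < 1 \<Longrightarrow> disk_auto a (\<zeta> * disk_auto l z) = \<eta> * disk_auto \<alpha> z"
proof
  have \<zeta>: "\<zeta> * cnj \<zeta> = 1" using assms(3) complex_norm_square[of \<zeta>] by simp
  define X where "X = \<zeta> - a * cnj l"
  define Y where "Y = 1 - cnj a * \<zeta> * l"
  define \<alpha> where "\<alpha> = disk_auto l (cnj \<zeta> * a)"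
  have \<zeta>a: "cmod (cnj \<zeta> * a) < 1" "cmod (cnj a * \<zeta>) < 1"
    using assms by (simp_all add: norm_mult)
  have Y: "Y \<noteq> 0"
    using one_minus_cnj_mult_nonzero[of "cnj \<zeta> * a" l] \<zeta>a(1) assms(2) 
    by (simp add: Y_def mult_ac)
  \<comment> \<open>Clearing denominators, the composite is \<open>- X * (\<alpha> - z)\<close> over \<open>Y * (1 - cnj \<alpha> * z)\<close>;
    the next step shows that the prefactor is unimodular.\<close>
  have XY: "X = \<zeta> * cnj Y" using \<zeta> by (simp add: X_def Y_def algebra_simps)
  then have X: "X \<noteq> 0" using Y assms(3) by auto
  show "cmod (- X / Y) = 1"
    using Y assms(3) by (simp add: XY norm_divide norm_mult)
  show \<alpha>1: "cmod \<alpha> < 1" unfolding \<alpha>_def by (intro norm_disk_auto_lt_1 assms \<zeta>a)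
  have \<alpha>X: "\<alpha> * X = \<zeta> * l - a"
  proof -
    have "X = \<zeta> * (1 - cnj l * (cnj \<zeta> * a))" using \<zeta> by (simp add: X_def algebra_simps)
    moreover have "1 - cnj l * (cnj \<zeta> * a) \<noteq> 0"
      using one_minus_cnj_mult_nonzero[of l "cnj \<zeta> * a"] \<zeta>a(1) assms(2) by simp
    ultimately have "\<alpha> * X = \<zeta> * (l - cnj \<zeta> * a)"
      by (simp add: \<alpha>_def disk_auto_def)
    also have "\<dots> = \<zeta> * l - a" using \<zeta> by (simp add: right_diff_distrib flip: mult.assoc)
    finally show ?thesis .
  qed
  have \<alpha>Y: "cnj \<alpha> * Y = cnj l - cnj a * \<zeta>"
  proof -
    have "cnj \<alpha> * cnj X = cnj \<zeta> * cnj l - cnj a" using arg_cong[OF \<alpha>X, of cnj] by simp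
    then have "\<zeta> * (cnj \<alpha> * (cnj \<zeta> * Y)) = \<zeta> * (cnj \<zeta> * cnj l - cnj a)" by (simp add: XY)
    then have "(\<zeta> * cnj \<zeta>) * (cnj \<alpha> * Y) = (\<zeta> * cnj \<zeta>) * cnj l - cnj a * \<zeta>"
      by (simp add: algebra_simps)
    then show ?thesis using \<zeta> by simp
  qed
  fix z assume z: "cmod z < 1"
  have nz: "1 - cnj l * z \<noteq> 0" "1 - cnj \<alpha> * z \<noteq> 0"
    using one_minus_cnj_mult_nonzero z assms \<alpha>1 by auto
  have "disk_auto a (\<zeta> * disk_auto l z)
      = (a * (1 - cnj l * z) - \<zeta> * (l - z)) / ((1 - cnj l * z) - cnj a * \<zeta> * (l - z))"
  proof -
    have "a - \<zeta> * disk_auto l z = (a * (1 - cnj l * z) - \<zeta> * (l - z)) / (1 - cnj l * z)"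
      "1 - cnj a * (\<zeta> * disk_auto l z)
        = ((1 - cnj l * z) - cnj a * \<zeta> * (l - z)) / (1 - cnj l * z)"
      using nz(1) by (simp_all add: disk_auto_def field_simps)
    then show ?thesis using nz(1) by (simp add: disk_auto_def[of a])
  qed
  also have "a * (1 - cnj l * z) - \<zeta> * (l - z) = - X * (\<alpha> - z)"
    using \<alpha>X by (simp add: X_def algebra_simps)
  also have "(1 - cnj l * z) - cnj a * \<zeta> * (l - z) = Y * (1 - cnj \<alpha> * z)"
    using arg_cong[OF \<alpha>Y, of "\<lambda>t. t * z"] by (simp add: Y_def algebra_simps)
  finally show "disk_auto a (\<zeta> * disk_auto l z) = (- X / Y) * disk_auto \<alpha> z"
    by (simp add: disk_auto_def)
qed

lemma artanh_real_mono:
  fixes x y :: real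
  assumes "0 \<le> x" "x \<le> y" "y < 1"
  shows "artanh x \<le> artanh y"
proof -
  have "(1 + x) / (1 - x) \<le> (1 + y) / (1 - y)"
    using assms by (intro frac_le) auto
  then show ?thesis
    using assms by (auto simp: artanh_def ln_le_cancel_iff)
qed

section \<open>Degree-three Blaschke products with a double zero at the origin\<close>

text \<open>
  For the Blaschke product \<open>B z = z\<^sup>2 * disk_auto a z\<close>, both \<open>B l - B d\<close> and
  \<open>1 - cnj (B l) * B d\<close> contain the corresponding expression for the identity map as a factor.
  The two polynomials below are the cofactors (the first up to sign), after clearing the denominators of
  \<open>disk_auto\<close>.
\<close>

definition Blaschke_num :: "complex \<Rightarrow> complex \<Rightarrow> complex \<Rightarrow> complex"
  where "Blaschke_num l d a =
    l*d*(a * cnj a) - (l+d)*(a + cnj a*(l*d)) + l\<^sup>2 + l*d + d\<^sup>2"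

definition Blaschke_den :: "complex \<Rightarrow> complex \<Rightarrow> complex \<Rightarrow> complex"
  where "Blaschke_den l d a =
    cnj l*d*(a * cnj a) - (1 + cnj l*d)*(a * cnj l + cnj a*d) + 1 + cnj l*d + (cnj l*d)\<^sup>2"

lemma norm_sq_disk_auto_lt_1:
  assumes "cmod a < 1" "cmod l < 1"
  shows "cmod (l\<^sup>2 * disk_auto a l) < 1"
proof -
  have "(cmod l)\<^sup>2 * cmod (disk_auto a l) \<le> 1 * cmod (disk_auto a l)"
    using assms by (intro mult_right_mono) (auto simp: power_le_one)
  then show ?thesis
    using norm_disk_auto_lt_1[OF assms] by (simp add: norm_mult norm_power)
qed

lemma one_minus_Blaschke:
  assumes "cmod a < 1" "cmod l < 1" "cmod d < 1"
  shows "1 - cnj (l\<^sup>2 * disk_auto a l) * (d\<^sup>2 * disk_auto a d)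
      = (1 - cnj l * d) * Blaschke_den l d a / ((1 - a * cnj l) * (1 - cnj a * d))"
proof -
  have nz: "1 - cnj a * d \<noteq> 0" "1 - a * cnj l \<noteq> 0" 
    using one_minus_cnj_mult_nonzero[of a d] one_minus_cnj_mult_nonzero[of l a]
      assms by (auto simp: mult.commute)
  show ?thesis
    using nz by (simp add: disk_auto_def Blaschke_den_def divide_simps)
      (simp add: algebra_simps power2_eq_square)
qed

lemma Blaschke_den_nonzero:
  assumes "cmod a < 1" "cmod l < 1" "cmod d < 1"
  shows "Blaschke_den l d a \<noteq> 0"
  using one_minus_Blaschke[OF assms] one_minus_cnj_mult_nonzero
    [OF norm_sq_disk_auto_lt_1[OF assms(1,2)]
       less_imp_le[OF norm_sq_disk_auto_lt_1[OF assms(1,3)]]] by auto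

lemma pseudo_hyperbolic_Blaschke:
  assumes "cmod a < 1" "cmod l < 1" "cmod d < 1"
  shows "pseudo_hyperbolic (l\<^sup>2 * disk_auto a l) (d\<^sup>2 * disk_auto a d)
    = pseudo_hyperbolic l d * (cmod (Blaschke_num l d a) / cmod (Blaschke_den l d a))"
proof -
  have nz: "1 - cnj a * d \<noteq> 0" "1 - a * cnj l \<noteq> 0" "1 - cnj a * l \<noteq> 0"
    using one_minus_cnj_mult_nonzero[of a d] one_minus_cnj_mult_nonzero[of l a]
      one_minus_cnj_mult_nonzero[of a l] assms by (auto simp: mult.commute)
  have num: "l\<^sup>2 * disk_auto a l - d\<^sup>2 * disk_auto a d
      = - ((l - d) * Blaschke_num l d a) / ((1 - cnj a * l) * (1 - cnj a * d))"
    using nz by (simp add: disk_auto_def Blaschke_num_def divide_simps)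
      (simp add: algebra_simps power2_eq_square)
  have cn: "cmod (1 - a * cnj l) = cmod (1 - cnj a * l)"
    by (metis complex_cnj_cnj complex_cnj_diff complex_cnj_mult complex_cnj_one complex_mod_cnj)
  show ?thesis
    using nz unfolding pseudo_hyperbolic_def num one_minus_Blaschke[OF assms]
      norm_divide norm_mult norm_minus_cancel cn
    by (simp add: divide_simps)
qed

lemma pseudo_hyperbolic_squares:
  "pseudo_hyperbolic (l\<^sup>2) (d\<^sup>2)
    = pseudo_hyperbolic l d * (cmod (l + d) / cmod (1 + cnj l * d))"
proof -
  have "l\<^sup>2 - d\<^sup>2 = (l - d) * (l + d)" 
    "1 - cnj (l\<^sup>2) * d\<^sup>2 = (1 - cnj l * d) * (1 + cnj l * d)"
    by (simp_all add: algebra_simps power2_eq_square)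
  then show ?thesis
    by (simp add: pseudo_hyperbolic_def norm_divide norm_mult del: complex_cnj_power)
qed

text \<open>
  This identity drives both cases of the theorem. The middle point \<open>c\<close> is distinguished because,
  in the variable \<open>b = a - c\<close>, both polynomials become multiples of
  \<open>(b - p) * (cnj b + cnj p) - 1\<close> for a suitable \<open>p\<close>, and \<open>b \<mapsto> -b\<close> conjugates this expression.
  Their moduli are therefore even in \<open>b\<close>. On the circle \<open>|a| = 1\<close> the Blaschke factor is a
  constant, so the ratio of the moduli is that of the squaring map, namely
  \<open>|l + d| / |1 + cnj l * d|\<close>. Hence the difference of the two sides vanishes on the circle
  \<open>|b + c| = 1\<close> and, being even, on the reflected circle \<open>|b - c| = 1\<close>; comparing terms of degree
  four in \<open>b\<close> gives the remaining constant factor.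
\<close>

lemma Blaschke_identity:
  fixes l d a c :: complex
  assumes "l \<noteq> 0" "d \<noteq> 0"
    and c: "c = 1 / 2 * (1 / cnj l + l + 1 / cnj d + d)"
  shows "(cmod (Blaschke_num l d a))\<^sup>2 * (cmod (1 + cnj l * d))\<^sup>2
    = (cmod (l + d))\<^sup>2 * (cmod (Blaschke_den l d a))\<^sup>2
      + (1 - (cmod l)\<^sup>2) * (1 - (cmod d)\<^sup>2) * (cmod (l * d))\<^sup>2
         * (((cmod a)\<^sup>2 - 1) * ((cmod (a - 2 * c))\<^sup>2 - 1))"
proof -
  \<comment> \<open>The conjugates may be treated as independent variables.\<close>
  have poly: "(l*d*(a*a') - (l+d)*(a + a'*(l*d)) + l\<^sup>2+l*d+d\<^sup>2)
      * (l'*d'*(a*a') - (l'+d')*(a' + a*(l'*d')) + l'\<^sup>2+l'*d'+d'\<^sup>2)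
      * ((1+l'*d)*(1+l*d'))
    - (l+d)*(l'+d') * ((l'*d*(a*a') - (1+l'*d)*(a*l'+a'*d) + 1+l'*d+(l'*d)\<^sup>2)
      * (l*d'*(a*a') - (1+l*d')*(a'*l+a*d') + 1+l*d'+(l*d')\<^sup>2))
    = (1-l*l')*(1-d*d')*(a*a'-1)
      * (((a*l'*d' - (d'+l*l'*d' + l'+l'*d*d'))*(a'*l*d - (d+l*l'*d + l+l*d*d'))) - l*l'*d*d')"
    for a' l' d' :: complex
    by algebra
  \<comment> \<open>The last bracket of the polynomial identity is \<open>|l d|\<^sup>2 (|a - 2c|\<^sup>2 - 1)\<close>.\<close>
  have two_c: "cnj l * cnj d * (2 * c)
      = cnj d + l * cnj l * cnj d + cnj l + cnj l * d * cnj d"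
    using assms by (simp add: c field_simps)
  have two_c': "l * d * (2 * cnj c) = d + l * cnj l * d + l + l * d * cnj d"
    using arg_cong[OF two_c, of cnj] by (simp add: mult_ac)
  have fact: "(a * cnj l * cnj d - cnj l * cnj d * (2 * c)) * (cnj a * l * d - l * d * (2 * cnj c))
      - l * cnj l * d * cnj d
      = (l * d) * cnj (l * d) * ((a - 2 * c) * cnj (a - 2 * c) - 1)"
    by (simp add: algebra_simps)
  have "complex_of_real ((cmod (Blaschke_num l d a))\<^sup>2 * (cmod (1 + cnj l * d))\<^sup>2)
      = complex_of_real ((cmod (l + d))\<^sup>2 * (cmod (Blaschke_den l d a))\<^sup>2
      + (1 - (cmod l)\<^sup>2) * (1 - (cmod d)\<^sup>2) * (cmod (l * d))\<^sup>2
         * (((cmod a)\<^sup>2 - 1) * ((cmod (a - 2 * c))\<^sup>2 - 1)))"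
    using poly[of "cnj a" "cnj l" "cnj d"]
    unfolding two_c[symmetric] two_c'[symmetric] fact
    by (simp only: of_real_add of_real_mult of_real_diff of_real_1 complex_norm_square
        Blaschke_num_def Blaschke_den_def complex_cnj_add complex_cnj_diff complex_cnj_mult
        complex_cnj_cnj complex_cnj_power complex_cnj_one)
       (simp only: algebra_simps)
  then show ?thesis by (simp only: of_real_eq_iff)
qed

lemma Blaschke_den_centred:
  assumes "l \<noteq> 0" "d \<noteq> 0"
    and c: "c = 1 / 2 * (1 / cnj l + l + 1 / cnj d + d)"
    and p: "p = 1 / 2 * (1 / cnj l + d - 1 / cnj d - l)"
  shows "Blaschke_den l d a = cnj l * d * ((a - c - p) * (cnj (a - c) + cnj p) - 1)"
proof -
  have cp: "c + p = 1 / cnj l + d" and cm: "cnj (c - p) = 1 / d + cnj l"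
    by (simp_all add: c p algebra_simps)
  have "(a - c - p) * (cnj (a - c) + cnj p) = (a - (c + p)) * (cnj a - cnj (c - p))"
    by (simp add: algebra_simps)
  then show ?thesis
    unfolding cp cm Blaschke_den_def using assms(1,2)
    by (simp add: field_simps power2_eq_square)
qed

text \<open>
  The last factor on the right is that of \<open>Blaschke_den_centred\<close>, whose value at \<open>a = c\<close> has modulus
  \<open>1 + |p|\<^sup>2\<close>; so this compares \<open>(|a|\<^sup>2 - 1) * (|a - 2c|\<^sup>2 - 1) / |den|\<^sup>2\<close> at \<open>a\<close> with its value at \<open>c\<close>.
  By the parallelogram law the two factors average to \<open>|a - c|\<^sup>2 + |c|\<^sup>2 - 1\<close>, which bounds their
  product, and the denominator is bounded below by its real part, which depends
  on \<open>|a - c|\<close> only. What is left, when both factors are negative, is a linear inequality in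
  \<open>|a - c|\<^sup>2\<close>; otherwise their product is nonpositive.
\<close>

lemma critical_comparison:
  fixes a c p :: complex
  assumes "cmod c < 1" "cmod a < 1"
  shows "((cmod a)\<^sup>2 - 1) * ((cmod (a - 2 * c))\<^sup>2 - 1) * (1 + (cmod p)\<^sup>2)\<^sup>2
     \<le> (1 - (cmod c)\<^sup>2)\<^sup>2 * (cmod ((a - c - p) * (cnj (a - c) + cnj p) - 1))\<^sup>2"
proof -
  define u where "u = (cmod a)\<^sup>2 - 1"
  define v where "v = (cmod (a - 2 * c))\<^sup>2 - 1"
  define x where "x = (cmod (a - c))\<^sup>2"
  define e where "e = 1 - (cmod c)\<^sup>2"
  define D where "D = 1 + (cmod p)\<^sup>2"
  define w where "w = (a - c - p) * (cnj (a - c) + cnj p) - 1"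
  have parallelogram: "u + v = 2 * (x - e)"
    unfolding u_def v_def x_def e_def cmod_power2
    by (simp add: power2_eq_square algebra_simps)
  have Re_w: "Re w = x - D"
    unfolding w_def x_def D_def cmod_power2
    by (simp add: power2_eq_square algebra_simps)
  have bounds: "0 < e" "e \<le> 1" "1 \<le> D" "0 \<le> x" "u < 0"
    using assms by (auto simp: e_def D_def x_def u_def power_less_one_iff)
  have "u * v * D\<^sup>2 \<le> e\<^sup>2 * (cmod w)\<^sup>2"
  proof (cases "v < 0")
    case False
    then have "u * v \<le> 0" using bounds by (simp add: mult_le_0_iff)
    then have "u * v * D\<^sup>2 \<le> 0" by (simp add: mult_le_0_iff)
    also have "0 \<le> e\<^sup>2 * (cmod w)\<^sup>2" by simp
    finally show ?thesis .
  next
    case True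
    then have "2 * (x - e) < 0" using bounds(5) unfolding parallelogram[symmetric] by simp
    then have "x < e" by simp
    have "u * v \<le> ((u + v) / 2)\<^sup>2"
      using zero_le_power2[of "u - v"] by (simp add: power2_eq_square field_simps)
    also have "(u + v) / 2 = x - e" using parallelogram by simp
    finally have "u * v * D\<^sup>2 \<le> (e - x)\<^sup>2 * D\<^sup>2"
      by (intro mult_right_mono) (simp_all add: power2_commute)
    also have "\<dots> = ((e - x) * D)\<^sup>2" by (simp add: power_mult_distrib)
    also have "\<dots> \<le> (e * (D - x))\<^sup>2"
    proof (rule power_mono)
      have "e * x \<le> D * x" using bounds by (intro mult_right_mono) auto
      then show "(e - x) * D \<le> e * (D - x)" by (simp add: algebra_simps)
      show "0 \<le> (e - x) * D" using \<open>x < e\<close> bounds by simp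
    qed
    also have "\<dots> = e\<^sup>2 * (Re w)\<^sup>2" by (simp add: Re_w power_mult_distrib power2_commute)
    also have "\<dots> \<le> e\<^sup>2 * (cmod w)\<^sup>2"
      by (intro mult_left_mono) (auto simp: cmod_power2)
    finally show ?thesis .
  qed
  then show ?thesis by (simp add: u_def v_def e_def D_def w_def)
qed

section \<open>The extremal problem\<close>

definition critical_param :: "complex \<Rightarrow> complex \<Rightarrow> complex"
  where "critical_param l d = 1 / 2 * (1 / cnj l + l + 1 / cnj d + d)"

definition extremal_distance :: "complex \<Rightarrow> complex \<Rightarrow> real"
  where "extremal_distance l d =
    (let c = critical_param l d in
     if cmod c \<ge> 1 then pseudo_hyperbolic (l\<^sup>2) (d\<^sup>2)
     else pseudo_hyperbolic (l\<^sup>2 * disk_auto c l) (d\<^sup>2 * disk_auto c d))"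

lemma extremal_distance_lt_1:
  assumes "cmod l < 1" "cmod d < 1"
  shows "extremal_distance l d < 1"
  using assms
  by (auto simp: extremal_distance_def Let_def norm_power power_less_one_iff norm_sq_disk_auto_lt_1
      intro!: pseudo_hyperbolic_lt_1)

text \<open>
  Only \<open>|c| < 1\<close> needs an argument. At \<open>a = c\<close> the last term of \<open>Blaschke_identity\<close> is a nonnegative multiple of
  \<open>(|c|\<^sup>2 - 1)\<^sup>2\<close>, so the Blaschke product with parameter \<open>c\<close> does at least as well as the
  squaring map.
\<close>

lemma pseudo_hyperbolic_squares_le_extremal:
  assumes "cmod l < 1" "cmod d < 1" "l \<noteq> 0" "d \<noteq> 0"
  shows "pseudo_hyperbolic (l\<^sup>2) (d\<^sup>2) \<le> extremal_distance l d"
proof (cases "cmod (critical_param l d) \<ge> 1")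
  case True
  then show ?thesis by (simp add: extremal_distance_def)
next
  case False
  define c where "c = critical_param l d"
  have c: "cmod c < 1" using False by (simp add: c_def)
  have nz: "Blaschke_den l d c \<noteq> 0" "1 + cnj l * d \<noteq> 0"
    using Blaschke_den_nonzero one_plus_cnj_mult_nonzero assms c by auto
  have norm_c: "cmod (c - 2 * c) = cmod c" 
    by (metis diff_add_cancel mult_2 minus_diff_eq norm_minus_cancel add_diff_cancel)
  have "(cmod (l + d) * cmod (Blaschke_den l d c))\<^sup>2
      \<le> (cmod (Blaschke_num l d c) * cmod (1 + cnj l * d))\<^sup>2"
    unfolding power_mult_distrib
      Blaschke_identity[OF assms(3,4) c_def[unfolded critical_param_def], of c] norm_c
    using assms by (auto simp: power_le_one intro!: mult_nonneg_nonneg)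
  then have "cmod (l + d) * cmod (Blaschke_den l d c)
      \<le> cmod (Blaschke_num l d c) * cmod (1 + cnj l * d)"
    by (rule power2_le_imp_le) simp
  then have "cmod (l + d) / cmod (1 + cnj l * d)
      \<le> cmod (Blaschke_num l d c) / cmod (Blaschke_den l d c)"
    using nz by (simp add: field_simps)
  from mult_left_mono[OF this pseudo_hyperbolic_nonneg[of l d]] show ?thesis
    unfolding extremal_distance_def c_def[symmetric] Let_def
      pseudo_hyperbolic_squares pseudo_hyperbolic_Blaschke[OF c assms(1,2)]
    using c by simp
qed

text \<open>
  If \<open>|c| \<ge> 1\<close>, then \<open>|a - 2c| \<ge> 1\<close> for every \<open>a\<close> in the disk, so the last term of
  \<open>Blaschke_identity\<close> is nonpositive and the squaring map wins. If \<open>|c| < 1\<close>, the identities at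
  \<open>a\<close> and at \<open>c\<close> reduce the claim to \<open>critical_comparison\<close>.
\<close>

lemma pseudo_hyperbolic_Blaschke_le_extremal:
  assumes "cmod a < 1" "cmod l < 1" "cmod d < 1" "l \<noteq> 0" "d \<noteq> 0"
  shows "pseudo_hyperbolic (l\<^sup>2 * disk_auto a l) (d\<^sup>2 * disk_auto a d) \<le> extremal_distance l d"
proof -
  define c where "c = critical_param l d"
  define p where "p = 1 / 2 * (1 / cnj l + d - 1 / cnj d - l)"
  define A where "A = (1 - (cmod l)\<^sup>2) * (1 - (cmod d)\<^sup>2) * (cmod (l * d))\<^sup>2"
  note id = Blaschke_identity[OF assms(4,5) c_def[unfolded critical_param_def], folded A_def]
  note den = Blaschke_den_centred[OF assms(4,5) c_def[unfolded critical_param_def] p_def]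
  have A: "0 \<le> A" using assms by (simp add: A_def power_le_one)
  have nz: "Blaschke_den l d a \<noteq> 0" "1 + cnj l * d \<noteq> 0"
    using Blaschke_den_nonzero one_plus_cnj_mult_nonzero assms by auto
  show ?thesis
  proof (cases "cmod c \<ge> 1")
    case True
    have "2 * cmod c \<le> cmod a + cmod (a - 2 * c)"
      using norm_triangle_ineq4[of a "a - 2 * c"] by (simp add: norm_mult)
    then have "1 \<le> cmod (a - 2 * c)" using True assms(1) by simp
    then have "((cmod a)\<^sup>2 - 1) * ((cmod (a - 2 * c))\<^sup>2 - 1) \<le> 0"
      using assms(1) by (simp add: mult_le_0_iff power_le_one)
    then have "(cmod (Blaschke_num l d a) * cmod (1 + cnj l * d))\<^sup>2
        \<le> (cmod (l + d) * cmod (Blaschke_den l d a))\<^sup>2"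
      unfolding power_mult_distrib id using A by (simp add: mult_nonneg_nonpos)
    then have "cmod (Blaschke_num l d a) * cmod (1 + cnj l * d)
        \<le> cmod (l + d) * cmod (Blaschke_den l d a)"
      by (rule power2_le_imp_le) simp
    then have "cmod (Blaschke_num l d a) / cmod (Blaschke_den l d a)
        \<le> cmod (l + d) / cmod (1 + cnj l * d)"
      using nz by (simp add: field_simps)
    from mult_left_mono[OF this pseudo_hyperbolic_nonneg[of l d]] show ?thesis
      unfolding extremal_distance_def c_def[symmetric] Let_def
        pseudo_hyperbolic_squares pseudo_hyperbolic_Blaschke[OF assms(1-3)]
      using True by simp
  next
    case False
    then have c: "cmod c < 1" by simp
    have nzc: "Blaschke_den l d c \<noteq> 0"
      using Blaschke_den_nonzero assms c by auto
    define E where "E = ((cmod a)\<^sup>2 - 1) * ((cmod (a - 2 * c))\<^sup>2 - 1)"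
    define E0 where "E0 = ((cmod c)\<^sup>2 - 1) * ((cmod (c - 2 * c))\<^sup>2 - 1)"
    define n where "n = (cmod (Blaschke_num l d a))\<^sup>2"
    define n0 where "n0 = (cmod (Blaschke_num l d c))\<^sup>2"
    define m where "m = (cmod (Blaschke_den l d a))\<^sup>2"
    define m0 where "m0 = (cmod (Blaschke_den l d c))\<^sup>2"
    define q where "q = (cmod (1 + cnj l * d))\<^sup>2"
    define s where "s = (cmod (l + d))\<^sup>2"
    have pp: "cmod (- p * cnj p - 1) = 1 + (cmod p)\<^sup>2"
    proof -
      have "- p * cnj p - 1 = - complex_of_real (1 + (cmod p)\<^sup>2)"
        by (simp only: of_real_add of_real_1 complex_norm_square) simp
      then show ?thesis by (simp only: norm_minus_cancel norm_of_real) simp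
    qed
    have "m0 = (cmod (l * d))\<^sup>2 * (1 + (cmod p)\<^sup>2)\<^sup>2"
      unfolding m0_def den norm_mult power_mult_distrib using pp by simp
    moreover have "m = (cmod (l * d))\<^sup>2 * (cmod ((a - c - p) * (cnj (a - c) + cnj p) - 1))\<^sup>2"
      unfolding m_def den norm_mult power_mult_distrib by simp
    moreover have "cmod (c - 2 * c) = cmod c"
      by (metis diff_add_cancel mult_2 minus_diff_eq norm_minus_cancel add_diff_cancel)
    then have "E0 = (1 - (cmod c)\<^sup>2)\<^sup>2"
      by (simp add: E0_def power2_eq_square algebra_simps)
    ultimately have "E * m0 \<le> E0 * m"
      using mult_left_mono[OF critical_comparison[OF c assms(1), of p], of "(cmod (l * d))\<^sup>2"]
      by (simp add: E_def mult_ac)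
    moreover have "n * q = s * m + A * E" "n0 * q = s * m0 + A * E0"
      using id[of a] id[of c] by (simp_all add: n_def n0_def q_def s_def m_def m0_def E_def E0_def)
    ultimately have "(n * m0) * q \<le> (n0 * m) * q"
    proof -
      assume *: "E * m0 \<le> E0 * m" "n * q = s * m + A * E" "n0 * q = s * m0 + A * E0"
      have "(n * m0) * q = s * m * m0 + A * (E * m0)"
        using *(2) by (simp add: algebra_simps)
      also have "\<dots> \<le> s * m * m0 + A * (E0 * m)"
        using *(1) A by (intro add_left_mono mult_left_mono) auto
      also have "\<dots> = (n0 * m) * q"
        using *(3) by (simp add: algebra_simps)
      finally show ?thesis .
    qed
    moreover have "0 < q" using nz by (simp add: q_def)
    ultimately have "n * m0 \<le> n0 * m" by (simp only: mult_le_cancel_right_pos)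
    then have "(cmod (Blaschke_num l d a) * cmod (Blaschke_den l d c))\<^sup>2
        \<le> (cmod (Blaschke_num l d c) * cmod (Blaschke_den l d a))\<^sup>2"
      by (simp add: n_def n0_def m_def m0_def power_mult_distrib)
    then have "cmod (Blaschke_num l d a) * cmod (Blaschke_den l d c)
        \<le> cmod (Blaschke_num l d c) * cmod (Blaschke_den l d a)"
      by (rule power2_le_imp_le) simp
    then have "cmod (Blaschke_num l d a) / cmod (Blaschke_den l d a)
        \<le> cmod (Blaschke_num l d c) / cmod (Blaschke_den l d c)"
      using nz nzc by (simp add: field_simps)
    from mult_left_mono[OF this pseudo_hyperbolic_nonneg[of l d]] show ?thesis
      unfolding extremal_distance_def c_def[symmetric] Let_def
        pseudo_hyperbolic_Blaschke[OF assms(1-3)] pseudo_hyperbolic_Blaschke[OF c assms(2,3)]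
      using c by simp
  qed
qed

text \<open>
  A self-map of the disk with value \<open>a\<close> at \<open>l\<close> takes a value of the form
  \<open>disk_auto a (\<zeta> * disk_auto l d)\<close> at \<open>d\<close>, with \<open>|\<zeta>| \<le> 1\<close>. The distance in question is the modulus of a
  holomorphic function of \<open>\<zeta>\<close>, so the maximum modulus principle moves \<open>\<zeta>\<close> to the unit circle, where
  the two values are interpolated by a rotated disk automorphism.
\<close>

lemma pseudo_hyperbolic_interpolation_le_extremal:
  assumes "cmod a < 1" "cmod l < 1" "cmod d < 1" "l \<noteq> 0" "d \<noteq> 0" "cmod \<zeta> \<le> 1"
  shows "pseudo_hyperbolic (l\<^sup>2 * a) (d\<^sup>2 * disk_auto a (\<zeta> * disk_auto l d)) \<le> extremal_distance l d"
proof -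
  define s where "s = disk_auto l d"
  define F where "F \<zeta> = disk_auto (l\<^sup>2 * a) (d\<^sup>2 * disk_auto a (\<zeta> * s))" for \<zeta>
  have s: "cmod s < 1" using norm_disk_auto_lt_1 assms by (simp add: s_def)
  have \<zeta>s: "cmod (w * s) < 1" if "cmod w \<le> 1" for w
    using mult_right_mono[OF that, of "cmod s"] s by (simp add: norm_mult)
  have small: "cmod (r\<^sup>2 * x) < 1" if "cmod r < 1" "cmod x < 1" for r x
    using mult_right_mono[of "(cmod r)\<^sup>2" 1 "cmod x"] that
    by (simp add: norm_mult norm_power power_le_one)
  have boundary: "cmod (F w) \<le> extremal_distance l d" if w: "cmod w = 1" for w
  proof -
    obtain \<eta> \<alpha> where \<eta>: "cmod \<eta> = 1" "cmod \<alpha> < 1"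
      "\<And>z. cmod z < 1 \<Longrightarrow> disk_auto a (w * disk_auto l z) = \<eta> * disk_auto \<alpha> z"
      using disk_auto_compose[OF assms(1,2) w] by blast
    have "a = \<eta> * disk_auto \<alpha> l"
      using \<eta>(3)[OF assms(2)] by (simp add: disk_auto_def)
    then have "cmod (F w) = pseudo_hyperbolic (\<eta> * (l\<^sup>2 * disk_auto \<alpha> l)) (\<eta> * (d\<^sup>2 * disk_auto \<alpha> d))"
      unfolding F_def s_def \<eta>(3)[OF assms(3)] pseudo_hyperbolic_eq_norm_disk_auto
      by (simp add: mult_ac)
    also have "\<dots> \<le> extremal_distance l d"
      unfolding pseudo_hyperbolic_rotate[OF \<eta>(1)]
      by (intro pseudo_hyperbolic_Blaschke_le_extremal assms \<eta>)
    finally show ?thesis .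
  qed
  have nz: "1 - cnj a * (w * s) \<noteq> 0"
    "1 - cnj (l\<^sup>2 * a) * (d\<^sup>2 * ((a - w * s) / (1 - cnj a * (w * s)))) \<noteq> 0"
    if w: "w \<in> cball 0 1" for w
  proof -
    have ws: "cmod (w * s) < 1" using \<zeta>s w by simp
    then show "1 - cnj a * (w * s) \<noteq> 0"
      using assms by (intro one_minus_cnj_mult_nonzero) auto
    show "1 - cnj (l\<^sup>2 * a) * (d\<^sup>2 * ((a - w * s) / (1 - cnj a * (w * s)))) \<noteq> 0"
      unfolding disk_auto_def[of a, symmetric]
      using small[OF assms(2,1)] small[OF assms(3) norm_disk_auto_lt_1[OF assms(1) ws]]
      by (intro one_minus_cnj_mult_nonzero) auto
  qed
  have "F holomorphic_on cball 0 1"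
    unfolding F_def disk_auto_def[of "l\<^sup>2 * a"] disk_auto_def[of a]
    by (intro holomorphic_intros) (erule nz)+
  then have "F holomorphic_on interior (cball 0 1)" "continuous_on (closure (cball 0 1)) F"
    by (auto elim: holomorphic_on_subset intro: holomorphic_on_imp_continuous_on)
  then have "cmod (F \<zeta>) \<le> extremal_distance l d"
    using assms(6) boundary
    by - (rule maximum_modulus_frontier[of F "cball 0 1"], auto)
  then show ?thesis by (simp add: F_def s_def pseudo_hyperbolic_eq_norm_disk_auto)
qed

section \<open>Self-maps of the disk with vanishing derivative at the origin\<close>

lemma disk_self_map_norm_lt_1:
  assumes "f ` \<bbbD> \<subseteq> \<bbbD>" "cmod z < 1"
  shows "cmod (f z) < 1"
  using assms by (simp add: image_subset_iff)

text \<open>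
  The Schwarz lemma for \<open>k = disk_auto (h l) \<circ> h \<circ> disk_auto l\<close>, evaluated at \<open>disk_auto l d\<close>.
\<close>

lemma Schwarz_Pick_interpolation:
  assumes holh: "h holomorphic_on \<bbbD>" and h_disk: "h ` \<bbbD> \<subseteq> \<bbbD>"
    and ld: "cmod l < 1" "cmod d < 1"
  obtains \<zeta> where "cmod \<zeta> \<le> 1" "h d = disk_auto (h l) (\<zeta> * disk_auto l d)"
proof -
  have h: "cmod (h z) < 1" if "cmod z < 1" for z using disk_self_map_norm_lt_1[OF h_disk that] .
  define k where "k z = disk_auto (h l) (h (disk_auto l z))" for z
  define w where "w = disk_auto l d"
  have w: "cmod w < 1" using norm_disk_auto_lt_1 ld by (simp add: w_def)
  have kd: "disk_auto (h l) (k w) = h d"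
    using ld h by (simp add: k_def w_def disk_auto_involution)
  have "disk_auto l holomorphic_on \<bbbD>"
    unfolding disk_auto_def
    using one_minus_cnj_mult_nonzero ld by (intro holomorphic_intros) auto
  then have "h \<circ> disk_auto l holomorphic_on \<bbbD>"
    using holh by (rule holomorphic_on_compose_gen) (use ld in \<open>auto simp: norm_disk_auto_lt_1\<close>)
  then have hol: "(\<lambda>z. h (disk_auto l z)) holomorphic_on \<bbbD>" by (simp add: o_def)
  have nz: "1 - cnj (h l) * h (disk_auto l z) \<noteq> 0" if "z \<in> \<bbbD>" for z
    using that h ld by (intro one_minus_cnj_mult_nonzero less_imp_le) (auto simp: norm_disk_auto_lt_1)
  have "k holomorphic_on \<bbbD>"
    unfolding k_def disk_auto_def[of "h l"]
    by (intro holomorphic_intros hol) (erule nz)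
  moreover have "k 0 = 0" by (simp add: k_def disk_auto_def[of l 0] disk_auto_def[of "h l"])
  moreover have "cmod (k z) < 1" if "cmod z < 1" for z
    unfolding k_def using that h ld by (intro norm_disk_auto_lt_1) (auto simp: norm_disk_auto_lt_1)
  ultimately have kw: "cmod (k w) \<le> cmod w"
    using w by (rule Schwarz_Lemma(1))
  show thesis
  proof
    show "cmod (k w / w) \<le> 1" using kw by (simp add: norm_divide divide_le_eq)
    \<comment> \<open>If \<open>w = 0\<close>, that is \<open>l = d\<close>, the witness is \<open>0\<close>, and \<open>k w = 0\<close> as well.\<close>
    have "k w / w * w = k w" using kw by (cases "w = 0") auto
    then show "h d = disk_auto (h l) (k w / w * disk_auto l d)"
      using kd by (simp add: w_def)
  qed
qed

text \<open>
  The Schwarz lemma twice: first for \<open>G\<close>, then for \<open>G z / z\<close>, which again vanishes at the origin.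
  The equality case of the second application has to be kept apart, because the quotient is then a
  constant of modulus one and not a map into the open disk.
\<close>

lemma bounded_holomorphic_double_zero:
  assumes holG: "G holomorphic_on \<bbbD>" and G_disk: "G ` \<bbbD> \<subseteq> \<bbbD>" and G0: "G 0 = 0" "deriv G 0 = 0"
  obtains (rotation) \<eta> where "cmod \<eta> = 1" "\<And>z. cmod z < 1 \<Longrightarrow> G z = \<eta> * z\<^sup>2"
  | (factor) h where "h holomorphic_on \<bbbD>" "h ` \<bbbD> \<subseteq> \<bbbD>"
      "\<And>z. cmod z < 1 \<Longrightarrow> G z = z\<^sup>2 * h z"
proof -
  have G: "cmod (G z) < 1" if "cmod z < 1" for z using disk_self_map_norm_lt_1[OF G_disk that] .
  obtain k where k: "k holomorphic_on \<bbbD>" "\<And>z. cmod z < 1 \<Longrightarrow> G z = z * k z" "deriv G 0 = k 0"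
    using Schwarz3[OF holG G0(1)] by blast
  have k0: "k 0 = 0" using k(3) G0(2) by simp
  have k1: "cmod (k z) < 1" if z: "cmod z < 1" for z
  proof (cases "z = 0")
    case False
    have le: "cmod (G z) \<le> cmod z" using holG G0(1) G z by (rule Schwarz_Lemma(1))
    \<comment> \<open>Equality would make \<open>G\<close> a rotation, whose derivative at the origin does not vanish.\<close>
    have "cmod (G z) \<noteq> cmod z"
    proof
      assume "cmod (G z) = cmod z"
      then obtain \<alpha> where \<alpha>: "\<And>z. cmod z < 1 \<Longrightarrow> G z = \<alpha> * z" "cmod \<alpha> = 1"
        using Schwarz_Lemma(3)[of G z, OF holG G0(1) _ z] G z False by blast
      have "deriv G 0 = deriv (\<lambda>z. \<alpha> * z) 0"
        by (rule deriv_cong_ev) (auto simp: eventually_nhds intro!: exI[of _ "\<bbbD>"] \<alpha>)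
      also have "\<dots> = \<alpha>" by simp
      finally show False using G0(2) \<alpha>(2) by simp
    qed
    then have "cmod z * cmod (k z) < cmod z * 1"
      using le k(2)[OF z] by (simp add: norm_mult)
    then show ?thesis using False by (simp add: mult_less_cancel_left_pos)
  qed (simp add: k0)
  obtain h where h: "h holomorphic_on \<bbbD>" "\<And>z. cmod z < 1 \<Longrightarrow> k z = z * h z" "deriv k 0 = h 0"
    using Schwarz3[OF k(1) k0] by blast
  have SL: "cmod (k z) \<le> cmod z" if "cmod z < 1" for z
    using k(1) k0 k1 that by (rule Schwarz_Lemma(1))
  have SL': "cmod (deriv k 0) \<le> 1"
    using k(1) k0 k1 by (rule Schwarz_Lemma(2)[of k 0]) auto
  show thesis
  proof (cases "(\<exists>z. norm z < 1 \<and> z \<noteq> 0 \<and> norm (k z) = norm z) \<or> norm (deriv k 0) = 1")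
    case True
    then obtain \<eta> where "\<And>z. cmod z < 1 \<Longrightarrow> k z = \<eta> * z" "cmod \<eta> = 1"
      using Schwarz_Lemma(3)[of k 0, OF k(1) k0] k1 by auto
    then show thesis using k(2) by (intro rotation[of \<eta>]) (auto simp: power2_eq_square)
  next
    case False
    have "cmod (h z) < 1" if z: "cmod z < 1" for z
    proof (cases "z = 0")
      case True
      then show ?thesis using SL' False h(3) by auto
    next
      case nz: False
      have "cmod (k z) < cmod z" using SL[OF z] False nz z by fastforce
      then have "cmod z * cmod (h z) < cmod z * 1" using h(2)[OF z] by (simp add: norm_mult)
      then show ?thesis using nz by (simp add: mult_less_cancel_left_pos)
    qed
    then show thesis
      using h k(2) by (intro factor[of h]) (auto simp: power2_eq_square)
  qed
qed

text \<open>
  Composing with the automorphism that moves \<open>g 0\<close> to the origin changes neither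
  pseudo-hyperbolic distances nor the vanishing of the derivative at the origin.
\<close>

lemma critical_function_normalise:
  assumes g: "g holomorphic_on \<bbbD>" "g ` \<bbbD> \<subseteq> \<bbbD>" "deriv g 0 = 0"
  defines "G \<equiv> \<lambda>z. disk_auto (g 0) (g z)"
  shows "G holomorphic_on \<bbbD>" "G ` \<bbbD> \<subseteq> \<bbbD>" "G 0 = 0" "deriv G 0 = 0"
proof -
  have g_disk: "cmod (g z) < 1" if "cmod z < 1" for z using disk_self_map_norm_lt_1[OF g(2) that] .
  have nz: "1 - cnj (g 0) * g z \<noteq> 0" if "cmod z < 1" for z
    using one_minus_cnj_mult_nonzero g_disk[of 0] g_disk[OF that] by simp
  show "G holomorphic_on \<bbbD>"
    unfolding G_def disk_auto_def using nz g(1) by (intro holomorphic_intros) auto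
  show "G ` \<bbbD> \<subseteq> \<bbbD>"
    unfolding G_def using g_disk by (auto intro!: norm_disk_auto_lt_1)
  show "G 0 = 0" by (simp add: G_def disk_auto_def)
  have "(g has_field_derivative 0) (at 0)"
    using holomorphic_derivI[OF g(1), of 0] g(3) by simp
  then have "(G has_field_derivative 0) (at 0)"
    unfolding G_def disk_auto_def using nz[of 0] by (auto intro!: derivative_eq_intros)
  then show "deriv G 0 = 0" by (rule DERIV_imp_deriv)
qed

lemma pseudo_hyperbolic_critical_le_extremal:
  assumes g: "g holomorphic_on \<bbbD>" "g ` \<bbbD> \<subseteq> \<bbbD>" "deriv g 0 = 0"
    and l: "cmod l < 1" "cmod d < 1" "l \<noteq> 0" "d \<noteq> 0"
  shows "pseudo_hyperbolic (g l) (g d) \<le> extremal_distance l d"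
proof -
  define G where "G = (\<lambda>z. disk_auto (g 0) (g z))"
  have G: "G holomorphic_on \<bbbD>" "G ` \<bbbD> \<subseteq> \<bbbD>" "G 0 = 0" "deriv G 0 = 0"
    unfolding G_def by (rule critical_function_normalise[OF g])+
  have "pseudo_hyperbolic (g l) (g d) = pseudo_hyperbolic (G l) (G d)"
    unfolding G_def using l
    by (intro pseudo_hyperbolic_disk_auto[symmetric] disk_self_map_norm_lt_1[OF g(2)]) auto
  also have "\<dots> \<le> extremal_distance l d"
    using G
  proof (cases rule: bounded_holomorphic_double_zero)
    case (rotation \<eta>)
    then show ?thesis
      using l by (simp add: pseudo_hyperbolic_rotate pseudo_hyperbolic_squares_le_extremal)
  next
    case (factor h)
    obtain \<zeta> where "cmod \<zeta> \<le> 1" "h d = disk_auto (h l) (\<zeta> * disk_auto l d)"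
      using Schwarz_Pick_interpolation[OF factor(1,2) l(1,2)] by blast
    then show ?thesis
      using pseudo_hyperbolic_interpolation_le_extremal[of "h l" l d \<zeta>]
        disk_self_map_norm_lt_1[OF factor(2) l(1)] factor(3) l by simp
  qed
  finally show ?thesis .
qed

lemma pseudo_hyperbolic_critical_origin:
  assumes g: "g holomorphic_on \<bbbD>" "g ` \<bbbD> \<subseteq> \<bbbD>" "deriv g 0 = 0"
    and l: "cmod l < 1"
  shows "pseudo_hyperbolic (g 0) (g l) \<le> (cmod l)\<^sup>2"
proof -
  define G where "G = (\<lambda>z. disk_auto (g 0) (g z))"
  have G: "G holomorphic_on \<bbbD>" "G ` \<bbbD> \<subseteq> \<bbbD>" "G 0 = 0" "deriv G 0 = 0"
    unfolding G_def by (rule critical_function_normalise[OF g])+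
  have "pseudo_hyperbolic (g 0) (g l) = cmod (G l)"
    by (simp add: G_def pseudo_hyperbolic_eq_norm_disk_auto)
  also have "\<dots> \<le> (cmod l)\<^sup>2"
    using G
  proof (cases rule: bounded_holomorphic_double_zero)
    case (rotation \<eta>)
    then show ?thesis using l by (simp add: norm_mult norm_power)
  next
    case (factor h)
    then show ?thesis
      using l mult_left_mono[of "cmod (h l)" 1 "(cmod l)\<^sup>2"]
      by (auto simp: norm_mult norm_power image_subset_iff less_imp_le)
  qed
  finally show ?thesis .
qed

section \<open>Holomorphic functions on the Neil parabola\<close>

lemma Neil_param_image: "Neil_param ` \<bbbD> = Neil_parabola"
proof (intro equalityI subsetI)
  fix x assume "x \<in> Neil_param ` \<bbbD>"
  then obtain t where "cmod t < 1" "x = Neil_param t" by auto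
  then show "x \<in> Neil_parabola"
    by (auto simp: Neil_param_def Neil_parabola_def norm_power power_less_one_iff
        simp flip: power_mult)
next
  fix x assume "x \<in> Neil_parabola"
  then obtain z w where x: "x = (z, w)" "cmod w < 1" "z\<^sup>2 = w ^ 3"
    by (auto simp: Neil_parabola_def)
  \<comment> \<open>At the cusp \<open>w = 0\<close> this is \<open>0\<close>, the right parameter, since division by zero gives zero.\<close>
  define t where "t = z / w"
  have t: "t\<^sup>2 = w" "t ^ 3 = z"
    using x(3) by (cases "w = 0"; simp add: t_def power_divide power2_eq_square power3_eq_cube)+
  have "(cmod t)\<^sup>2 < 1" using x(2) t(1) by (simp flip: norm_power)
  then have "t \<in> \<bbbD>" by (simp add: power_less_one_iff abs_square_less_1)
  then show "x \<in> Neil_param ` \<bbbD>" using x(1) t by (auto simp: Neil_param_def)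
qed

text \<open>
  Both coordinates of \<open>Neil_param\<close> have vanishing derivative at the origin, so by the chain rule every
  pullback has, whatever local extension is used.
\<close>

lemma Neil_pullback:
  assumes "f \<in> Neil_to_disk"
  shows "(f \<circ> Neil_param) holomorphic_on \<bbbD>" "(f \<circ> Neil_param) ` \<bbbD> \<subseteq> \<bbbD>"
    "deriv (f \<circ> Neil_param) 0 = 0"
proof -
  have deriv: "\<exists>a b. ((f \<circ> Neil_param) has_field_derivative (a * (3 * t\<^sup>2) + b * (2 * t))) (at t)"
    if t: "t \<in> \<bbbD>" for t
  proof -
    have "Neil_param t \<in> Neil_parabola" using t Neil_param_image by blast
    then obtain U F where U: "open U" "Neil_param t \<in> U" "holomorphic2_on F U"
      "\<forall>y\<in>U \<inter> Neil_parabola. F y = f y"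
      using assms unfolding Neil_to_disk_def holomorphic_on_Neil_def by blast
    obtain a b where F: "(F has_derivative (\<lambda>h. a * fst h + b * snd h)) (at (Neil_param t))"
      using U(2,3) unfolding holomorphic2_on_def by blast
    have "(Neil_param has_derivative (\<lambda>h. (h * (3 * t\<^sup>2), h * (2 * t)))) (at t)"
      unfolding Neil_param_def by (auto intro!: derivative_eq_intros simp: algebra_simps)
    from diff_chain_at[OF this F]
    have "((F \<circ> Neil_param) has_field_derivative (a * (3 * t\<^sup>2) + b * (2 * t))) (at t)"
      unfolding has_field_derivative_def by (rule has_derivative_eq_rhs) (simp add: fun_eq_iff algebra_simps)
    moreover have "open (\<bbbD> \<inter> Neil_param -` U)"
    proof (intro open_Int open_ball open_vimage U)
      show "continuous_on UNIV Neil_param" unfolding Neil_param_def by (intro continuous_intros)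
    qed
    ultimately have "((f \<circ> Neil_param) has_field_derivative (a * (3 * t\<^sup>2) + b * (2 * t))) (at t)"
      by (rule has_field_derivative_transform_within_open)
        (use t U Neil_param_image in auto)
    then show ?thesis by blast
  qed
  show "(f \<circ> Neil_param) holomorphic_on \<bbbD>"
    using deriv by (metis holomorphic_on_open open_ball)
  show "deriv (f \<circ> Neil_param) 0 = 0"
    using deriv[of 0] by (auto intro: DERIV_imp_deriv)
  show "(f \<circ> Neil_param) ` \<bbbD> \<subseteq> \<bbbD>"
    using assms unfolding image_comp[symmetric] Neil_param_image by (simp add: Neil_to_disk_def)
qed

lemma Neil_to_disk_global:
  assumes "holomorphic2_on F (\<bbbD> \<times> \<bbbD>)" "\<And>t. cmod t < 1 \<Longrightarrow> cmod (F (Neil_param t)) < 1"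
  shows "F \<in> Neil_to_disk"
proof -
  have "holomorphic_on_Neil F"
    unfolding holomorphic_on_Neil_def
    using assms(1) by (intro ballI exI[of _ "\<bbbD> \<times> \<bbbD>"] exI[of _ F])
      (auto simp: Neil_parabola_def open_Times)
  moreover have "F ` Neil_parabola \<subseteq> \<bbbD>"
    using assms(2) by (auto simp flip: Neil_param_image)
  ultimately show ?thesis by (simp add: Neil_to_disk_def)
qed

lemma snd_Neil_to_disk: "snd \<in> Neil_to_disk"
proof (rule Neil_to_disk_global)
  show "holomorphic2_on snd (\<bbbD> \<times> \<bbbD>)"
    unfolding holomorphic2_on_def
    by (intro ballI exI[of _ 0] exI[of _ 1]) (auto intro!: derivative_eq_intros)
qed (auto simp: Neil_param_def norm_power power_less_one_iff)

text \<open>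
  Multiplying numerator and denominator of \<open>disk_auto \<alpha> t\<close> by \<open>1 + cnj \<alpha> * t\<close> makes the denominator a
  function of \<open>t\<^sup>2\<close>. The factor \<open>t\<^sup>2\<close> leaves only powers from \<open>t\<^sup>2\<close> to \<open>t\<^sup>4\<close> in the numerator, which are
  \<open>w\<close>, \<open>z\<close> and \<open>w\<^sup>2\<close> at \<open>(z, w) = Neil_param t\<close>.
\<close>

lemma Blaschke_extends_Neil:
  assumes \<alpha>: "cmod \<alpha> < 1"
  obtains F where "F \<in> Neil_to_disk"
    "\<And>t. cmod t < 1 \<Longrightarrow> F (Neil_param t) = t\<^sup>2 * disk_auto \<alpha> t"
proof
  define F where "F = (\<lambda>x. (snd x * \<alpha> - fst x + \<alpha> * cnj \<alpha> * fst x - cnj \<alpha> * (snd x)\<^sup>2)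
      / (1 - (cnj \<alpha>)\<^sup>2 * snd x))"
  have \<alpha>2: "cmod (\<alpha>\<^sup>2) < 1" using \<alpha> by (simp add: norm_power power_less_one_iff)
  show F: "F (Neil_param t) = t\<^sup>2 * disk_auto \<alpha> t" if t: "cmod t < 1" for t
  proof -
    have "1 - cnj \<alpha> * t \<noteq> 0" "1 + cnj \<alpha> * t \<noteq> 0"
      using one_minus_cnj_mult_nonzero one_plus_cnj_mult_nonzero \<alpha> t by auto
    moreover have "1 - (cnj \<alpha>)\<^sup>2 * t\<^sup>2 = (1 - cnj \<alpha> * t) * (1 + cnj \<alpha> * t)"
      by (simp add: algebra_simps power2_eq_square)
    moreover have "t\<^sup>2 * \<alpha> - t ^ 3 + \<alpha> * cnj \<alpha> * t ^ 3 - cnj \<alpha> * (t\<^sup>2)\<^sup>2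
        = t\<^sup>2 * (\<alpha> - t) * (1 + cnj \<alpha> * t)"
      by (simp add: algebra_simps power2_eq_square power3_eq_cube)
    ultimately show ?thesis by (simp add: F_def Neil_param_def disk_auto_def)
  qed
  show "F \<in> Neil_to_disk"
  proof (rule Neil_to_disk_global)
    show "holomorphic2_on F (\<bbbD> \<times> \<bbbD>)"
      unfolding holomorphic2_on_def
    proof
      fix x :: "complex \<times> complex" assume "x \<in> \<bbbD> \<times> \<bbbD>"
      then have nz: "1 - (cnj \<alpha>)\<^sup>2 * snd x \<noteq> 0"
        using one_minus_cnj_mult_nonzero[OF \<alpha>2, of "snd x"] by (auto simp: mem_Times_iff)
      define N where "N = snd x * \<alpha> - fst x + \<alpha> * cnj \<alpha> * fst x - cnj \<alpha> * (snd x)\<^sup>2"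
      define D where "D = 1 - (cnj \<alpha>)\<^sup>2 * snd x"
      have "((\<lambda>x. snd x * \<alpha> - fst x + \<alpha> * cnj \<alpha> * fst x - cnj \<alpha> * (snd x)\<^sup>2)
          has_derivative (\<lambda>h. (\<alpha> * cnj \<alpha> - 1) * fst h + (\<alpha> - 2 * cnj \<alpha> * snd x) * snd h)) (at x)"
        by (rule derivative_eq_intros refl)+ (simp add: fun_eq_iff algebra_simps)
      moreover have "((\<lambda>x. 1 - (cnj \<alpha>)\<^sup>2 * snd x) has_derivative (\<lambda>h. - ((cnj \<alpha>)\<^sup>2 * snd h))) (at x)"
        by (rule derivative_eq_intros refl)+ simp
      ultimately have "(F has_derivative (\<lambda>h. - N * (inverse D * (- ((cnj \<alpha>)\<^sup>2 * snd h)) * inverse D)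
          + ((\<alpha> * cnj \<alpha> - 1) * fst h + (\<alpha> - 2 * cnj \<alpha> * snd x) * snd h) / D)) (at x)"
        unfolding F_def N_def D_def using nz by (rule has_derivative_divide)
      then have "(F has_derivative (\<lambda>h. (\<alpha> * cnj \<alpha> - 1) / D * fst h
          + ((\<alpha> - 2 * cnj \<alpha> * snd x) / D + N * (cnj \<alpha>)\<^sup>2 / D\<^sup>2) * snd h)) (at x)"
        by (rule has_derivative_eq_rhs)
          (simp add: fun_eq_iff divide_inverse power2_eq_square algebra_simps)
      then show "\<exists>a b. (F has_derivative (\<lambda>h. a * fst h + b * snd h)) (at x)" by blast
    qed
    show "cmod (F (Neil_param t)) < 1" if "cmod t < 1" for t
      using F[OF that] norm_sq_disk_auto_lt_1[OF \<alpha> that] by simp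
  qed
qed

text \<open>
  Reduces a Caratheodory distance to an extremal problem on the disk: an upper bound for all
  self-maps with vanishing derivative at the origin, and one function on the Neil parabola
  attaining it.
\<close>

lemma caratheodory_Neil_eqI:
  assumes "\<And>g. \<lbrakk>g holomorphic_on \<bbbD>; g ` \<bbbD> \<subseteq> \<bbbD>; deriv g 0 = 0\<rbrakk>
      \<Longrightarrow> pseudo_hyperbolic (g l) (g d) \<le> r"
    and "r < 1" and "F \<in> Neil_to_disk"
    and "pseudo_hyperbolic (F (Neil_param l)) (F (Neil_param d)) = r"
  shows "caratheodory_Neil (Neil_param l) (Neil_param d) = ereal (artanh r)"
  unfolding caratheodory_Neil_def
proof (rule antisym)
  show "(SUP f\<in>Neil_to_disk. ereal (poincare_dist (f (Neil_param l)) (f (Neil_param d))))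
      \<le> ereal (artanh r)"
  proof (rule SUP_least)
    fix f assume "f \<in> Neil_to_disk"
    from assms(1)[OF Neil_pullback[OF this]]
    show "ereal (poincare_dist (f (Neil_param l)) (f (Neil_param d))) \<le> ereal (artanh r)"
      using assms(2) by (simp add: poincare_dist_def artanh_real_mono pseudo_hyperbolic_nonneg)
  qed
  show "ereal (artanh r)
      \<le> (SUP f\<in>Neil_to_disk. ereal (poincare_dist (f (Neil_param l)) (f (Neil_param d))))"
    by (rule SUP_upper2[OF assms(3)]) (simp add: poincare_dist_def assms(4))
qed

section \<open>The Caratheodory distance on the Neil parabola\<close>

theorem theorem2p3:
  fixes l \<delta> \<alpha>\<^sub>0 :: complex
  assumes "l \<in> \<bbbD>" and "\<delta> \<in> \<bbbD>" and "l \<noteq> 0" and "\<delta> \<noteq> 0"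
    and "\<alpha>\<^sub>0 = 1 / 2 * (1 / cnj l + l + 1 / cnj \<delta> + \<delta>)"
  shows "caratheodory_Neil (Neil_param l) (Neil_param \<delta>) =
      (if cmod \<alpha>\<^sub>0 \<ge> 1
       then ereal (poincare_dist (l\<^sup>2) (\<delta>\<^sup>2))
       else ereal (poincare_dist (l\<^sup>2 * disk_auto \<alpha>\<^sub>0 l) (\<delta>\<^sup>2 * disk_auto \<alpha>\<^sub>0 \<delta>)))
    \<and> caratheodory_Neil (Neil_param 0) (Neil_param l) = ereal (poincare_dist 0 (l\<^sup>2))
    \<and> poincare_dist 0 (l\<^sup>2) = artanh ((cmod l)\<^sup>2)"
proof (intro conjI)
  have l: "cmod l < 1" and \<delta>: "cmod \<delta> < 1" using assms by auto
  have \<alpha>: "critical_param l \<delta> = \<alpha>\<^sub>0" by (simp add: critical_param_def assms(5))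
  note upper = pseudo_hyperbolic_critical_le_extremal[OF _ _ _ l \<delta> assms(3,4)]
  note lt_1 = extremal_distance_lt_1[OF l \<delta>]
  show "caratheodory_Neil (Neil_param l) (Neil_param \<delta>) =
      (if cmod \<alpha>\<^sub>0 \<ge> 1
       then ereal (poincare_dist (l\<^sup>2) (\<delta>\<^sup>2))
       else ereal (poincare_dist (l\<^sup>2 * disk_auto \<alpha>\<^sub>0 l) (\<delta>\<^sup>2 * disk_auto \<alpha>\<^sub>0 \<delta>)))"
  proof (cases "cmod \<alpha>\<^sub>0 \<ge> 1")
    case True
    then have "pseudo_hyperbolic (snd (Neil_param l)) (snd (Neil_param \<delta>)) = extremal_distance l \<delta>"
      by (simp add: extremal_distance_def \<alpha> Neil_param_def)
    then have "caratheodory_Neil (Neil_param l) (Neil_param \<delta>) = ereal (artanh (extremal_distance l \<delta>))"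
      by (intro caratheodory_Neil_eqI[OF _ lt_1 snd_Neil_to_disk] upper)
    then show ?thesis
      using True by (simp add: extremal_distance_def \<alpha> poincare_dist_def)
  next
    case False
    then obtain F where F: "F \<in> Neil_to_disk"
      "\<And>t. cmod t < 1 \<Longrightarrow> F (Neil_param t) = t\<^sup>2 * disk_auto \<alpha>\<^sub>0 t"
      using Blaschke_extends_Neil[of \<alpha>\<^sub>0] by auto
    then have "pseudo_hyperbolic (F (Neil_param l)) (F (Neil_param \<delta>)) = extremal_distance l \<delta>"
      using False l \<delta> by (simp add: extremal_distance_def \<alpha>)
    then have "caratheodory_Neil (Neil_param l) (Neil_param \<delta>) = ereal (artanh (extremal_distance l \<delta>))"
      by (intro caratheodory_Neil_eqI[OF _ lt_1 F(1)] upper)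
    then show ?thesis
      using False by (simp add: extremal_distance_def \<alpha> poincare_dist_def)
  qed
  show eq: "poincare_dist 0 (l\<^sup>2) = artanh ((cmod l)\<^sup>2)"
    by (simp add: poincare_dist_def pseudo_hyperbolic_0 norm_power)
  have "(cmod l)\<^sup>2 < 1" using l by (simp add: power_less_one_iff)
  moreover have "pseudo_hyperbolic (snd (Neil_param 0)) (snd (Neil_param l)) = (cmod l)\<^sup>2"
    by (simp add: Neil_param_def pseudo_hyperbolic_0 norm_power)
  ultimately show "caratheodory_Neil (Neil_param 0) (Neil_param l) = ereal (poincare_dist 0 (l\<^sup>2))"
    unfolding eq
    by (intro caratheodory_Neil_eqI[OF _ _ snd_Neil_to_disk] pseudo_hyperbolic_critical_origin l)
qed

end
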